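(* Let $0<q<1$ and $0<\lambda\le 1$, and let $a,b,c$ be parameters. For $k\ge 0$ put $$f_{q,k}(\rho)=q^c\frac{\Gamma_q(1+\rho+k\lambda)}{\Gamma_q(1+\rho+(k-2)\lambda)}+[c]_q\frac{\Gamma_q(1+\rho+k\lambda)}{\Gamma_q(1+\rho+(k-1)\lambda)},$$ $$g_{q,k}(\rho)=q^{a+b+1}\frac{\Gamma_q(1+\rho+k\lambda)}{\Gamma_q(1+\rho+(k-2)\lambda)}+\left(q^b[a]_q+q^a[b+1]_q\right)\frac{\Gamma_q(1+\rho+k\lambda)}{\Gamma_q(1+\rho+(k-1)\lambda)}+[a]_q[b]_q.$$ Let $\rho>-1$ satisfy $$f_{q,0}(\rho)=q^c\frac{\Gamma_q(1+\rho)}{\Gamma_q(1+\rho-2\lambda)}+[c]_q\frac{\Gamma_q(1+\rho)}{\Gamma_q(1+\rho-\lambda)}=0,$$ and define the fractional $q$-Gauss function as the series $$u(z)=u_0\,z^{\rho}\sum_{n=0}^{\infty}\left(\prod_{k=0}^{n}\frac{g_{q,k}(\rho)}{f_{q,k+1}(\rho)}\right)z^{n\lambda},$$ where $u_0$ is a constant. Then the fractional $q$-Gauss function $u$ is a solution of the fractional $q$-hypergeometric $q$-difference equation (fractional $q$-Gauss equation) $$z^\lambda\left(q^c-q^{a+b+1}z^\lambda\right)(D_q^{2\lambda}u)(z)+\left([c]_q-\left(q^b[a]_q+q^a[b+1]_q\right)z^\lambda\right)(D_q^{\lambda}u)(z)-[a]_q[b]_q\,u(z)=0.$$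
   Context: Here $[s]_q=\frac{1-q^s}{1-q}$, $(s;q)_n=\prod_{j=0}^{n-1}(1-sq^j)$, $(s;q)_\infty=\prod_{j=0}^\infty(1-sq^j)$, and the $q$-Gamma function is $\Gamma_q(x)=\frac{(q;q)_\infty}{(q^x;q)_\infty}(1-q)^{1-x}$. The fractional $q$-derivative of order $\alpha$ is $$(D_q^{\alpha}f)(x)=\frac{1}{x^{\alpha}(1-q)^{\alpha}}\sum_{n=0}^{\infty}\frac{(q^{-\alpha};q)_n}{(q;q)_n}q^n f(q^n x),$$ and $D_q^{2\lambda}$ is this operator of order $\alpha=2\lambda$. The solution is sought as a modified formal power series $\sum_{n\ge0}d_n z^{n\lambda+\rho}$, on which the operators act term by term by $D_q^{\alpha}z^{s}=\frac{\Gamma_q(s+1)}{\Gamma_q(s-\alpha+1)}z^{s-\alpha}$.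
   Formalization: The product in u(z) runs over k=0,…,n−1 instead of k=0,…,n, since the printed product does not satisfy the equation (e.g. λ=1, ρ=0, a=2, b=c=1), and f_{q,k+1}(ρ)≠0 for all k≥0 is assumed so that the coefficients are defined. *)

theory Defs
  imports "HOL-Analysis.Analysis"
begin

definition q_bracket :: "real \<Rightarrow> complex \<Rightarrow> complex" where
  "q_bracket q s = (1 - of_real q powr s) / (1 - of_real q)"

definition q_poch :: "real \<Rightarrow> real \<Rightarrow> nat \<Rightarrow> real" where
  "q_poch q s n = (\<Prod>j<n. 1 - s * q ^ j)"

definition q_poch_inf :: "real \<Rightarrow> real \<Rightarrow> real" where
  "q_poch_inf q s = (\<Prod>j. 1 - s * q ^ j)"

text \<open>At the poles \<open>x = 0, -1, -2, \<dots>\<close> the denominator vanishes, so the value is \<open>0\<close>, and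
  a quotient with \<open>q_Gamma q x\<close> in the denominator is \<open>0\<close> there as well. This agrees with the usual
  convention that \<open>1 / \<Gamma>\<^sub>q\<close> is entire and vanishes at the poles of \<open>\<Gamma>\<^sub>q\<close>.\<close>

definition q_Gamma :: "real \<Rightarrow> real \<Rightarrow> real" where
  "q_Gamma q x = q_poch_inf q q / q_poch_inf q (q powr x) * (1 - q) powr (1 - x)"

definition frac_q_deriv_term ::
    "real \<Rightarrow> real \<Rightarrow> (complex \<Rightarrow> complex) \<Rightarrow> complex \<Rightarrow> nat \<Rightarrow> complex" where
  "frac_q_deriv_term q \<alpha> f x n =
     of_real (q_poch q (q powr (-\<alpha>)) n / q_poch q q n * q ^ n) * f (of_real (q ^ n) * x)"

text \<open>Powers of the complex variable are taken with the principal branch.\<close>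

definition frac_q_deriv ::
    "real \<Rightarrow> real \<Rightarrow> (complex \<Rightarrow> complex) \<Rightarrow> complex \<Rightarrow> complex" where
  "frac_q_deriv q \<alpha> f x =
     1 / (x powr of_real \<alpha> * of_real ((1 - q) powr \<alpha>)) * (\<Sum>n. frac_q_deriv_term q \<alpha> f x n)"

definition frac_q_f :: "real \<Rightarrow> real \<Rightarrow> complex \<Rightarrow> nat \<Rightarrow> real \<Rightarrow> complex" where
  "frac_q_f q l c k \<rho> =
     of_real q powr c *
       of_real (q_Gamma q (1 + \<rho> + real k * l) / q_Gamma q (1 + \<rho> + (real k - 2) * l))
     + q_bracket q c *
       of_real (q_Gamma q (1 + \<rho> + real k * l) / q_Gamma q (1 + \<rho> + (real k - 1) * l))"

definition frac_q_g :: "real \<Rightarrow> real \<Rightarrow> complex \<Rightarrow> complex \<Rightarrow> nat \<Rightarrow> real \<Rightarrow> complex" where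
  "frac_q_g q l a b k \<rho> =
     of_real q powr (a + b + 1) *
       of_real (q_Gamma q (1 + \<rho> + real k * l) / q_Gamma q (1 + \<rho> + (real k - 2) * l))
     + (of_real q powr b * q_bracket q a + of_real q powr a * q_bracket q (b + 1)) *
       of_real (q_Gamma q (1 + \<rho> + real k * l) / q_Gamma q (1 + \<rho> + (real k - 1) * l))
     + q_bracket q a * q_bracket q b"

text \<open>The product has \<open>n\<close> factors, \<open>k = 0, \<dots>, n - 1\<close>: comparing coefficients of
  \<open>z\<^bsup>n l+\<rho>\<^esup>\<close> in the equation gives the recurrence \<open>f\<^bsub>n+1\<^esub> d\<^bsub>n+1\<^esub> = g\<^sub>n d\<^sub>n\<close> with
  \<open>d\<^sub>0 = u\<^sub>0\<close>. (A product running up to \<open>k = n\<close> does not satisfy it.)\<close>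

definition frac_q_gauss_coeff ::
    "real \<Rightarrow> real \<Rightarrow> complex \<Rightarrow> complex \<Rightarrow> complex \<Rightarrow> real \<Rightarrow> nat \<Rightarrow> complex" where
  "frac_q_gauss_coeff q l a b c \<rho> n =
     (\<Prod>k<n. frac_q_g q l a b k \<rho> / frac_q_f q l c (Suc k) \<rho>)"

definition frac_q_gauss ::
    "real \<Rightarrow> real \<Rightarrow> complex \<Rightarrow> complex \<Rightarrow> complex \<Rightarrow> real \<Rightarrow> complex \<Rightarrow> complex \<Rightarrow> complex" where
  "frac_q_gauss q l a b c \<rho> u0 z =
     u0 * z powr of_real \<rho> *
       (\<Sum>n. frac_q_gauss_coeff q l a b c \<rho> n * z powr of_real (real n * l))"

text \<open>Modified formal power series are encoded by their coefficient functions: \<open>F s\<close> is the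
  coefficient of \<open>z\<^bsup>s\<^esup>\<close>, for a real exponent \<open>s\<close>.\<close>

type_synonym formal_series = "real \<Rightarrow> complex"

text \<open>The series \<open>\<Sum>n. d n z\<^bsup>n l+\<rho>\<^esup>\<close>; for \<open>l \<noteq> 0\<close> the index set below has at most one element.\<close>

definition formal_of_coeffs :: "real \<Rightarrow> real \<Rightarrow> (nat \<Rightarrow> complex) \<Rightarrow> formal_series" where
  "formal_of_coeffs l \<rho> d = (\<lambda>s. \<Sum>n | s = real n * l + \<rho>. d n)"

text \<open>Multiplication by \<open>z\<^bsup>\<beta>\<^esup>\<close>.\<close>

definition formal_zpow_mult :: "real \<Rightarrow> formal_series \<Rightarrow> formal_series" where
  "formal_zpow_mult \<beta> F = (\<lambda>s. F (s - \<beta>))"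

text \<open>The termwise action \<open>z\<^bsup>t\<^esup> \<mapsto> \<Gamma>\<^sub>q(t + 1) / \<Gamma>\<^sub>q(t - \<alpha> + 1) z\<^bsup>t-\<alpha>\<^esup>\<close>: the coefficient of
  \<open>z\<^bsup>s\<^esup>\<close> in the image comes from the exponent \<open>t = s + \<alpha>\<close>.\<close>

definition formal_q_deriv :: "real \<Rightarrow> real \<Rightarrow> formal_series \<Rightarrow> formal_series" where
  "formal_q_deriv q \<alpha> F =
     (\<lambda>s. of_real (q_Gamma q ((s + \<alpha>) + 1) / q_Gamma q ((s + \<alpha>) - \<alpha> + 1)) * F (s + \<alpha>))"

text \<open>The left-hand side of the fractional \<open>q\<close>-Gauss equation, for formal series and for functions.\<close>

definition formal_q_gauss_lhs ::
    "real \<Rightarrow> real \<Rightarrow> complex \<Rightarrow> complex \<Rightarrow> complex \<Rightarrow> formal_series \<Rightarrow> formal_series" where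
  "formal_q_gauss_lhs q l a b c U =
     (let D2 = formal_q_deriv q (2 * l) U; D1 = formal_q_deriv q l U in
      (\<lambda>s. formal_zpow_mult l
              (\<lambda>t. of_real q powr c * D2 t
                   - of_real q powr (a + b + 1) * formal_zpow_mult l D2 t) s
            + (q_bracket q c * D1 s
               - (of_real q powr b * q_bracket q a + of_real q powr a * q_bracket q (b + 1))
                 * formal_zpow_mult l D1 s)
            - q_bracket q a * q_bracket q b * U s))"

definition q_gauss_lhs ::
    "real \<Rightarrow> real \<Rightarrow> complex \<Rightarrow> complex \<Rightarrow> complex \<Rightarrow> (complex \<Rightarrow> complex) \<Rightarrow> complex \<Rightarrow> complex" where
  "q_gauss_lhs q l a b c u z =
     z powr of_real l * (of_real q powr c - of_real q powr (a + b + 1) * z powr of_real l)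
       * frac_q_deriv q (2 * l) u z
     + (q_bracket q c
        - (of_real q powr b * q_bracket q a + of_real q powr a * q_bracket q (b + 1))
          * z powr of_real l) * frac_q_deriv q l u z
     - q_bracket q a * q_bracket q b * u z"

end

theory Submission
  imports Defs
begin

text \<open>
  Both halves rest on the recurrence \<open>f\<^bsub>n+1\<^esub> d\<^bsub>n+1\<^esub> = g\<^sub>n d\<^sub>n\<close> and on \<open>f\<^sub>0 = 0\<close>, which removes the
  term of exponent \<open>\<rho> - l\<close>. For functions one has to know that \<open>D\<^sub>q\<^sup>\<alpha>\<close> may be applied termwise.
  On a single power \<open>z\<^sup>s\<close> with \<open>s > -1\<close> the defining series is
  \<open>\<Sum>n. (q\<^bsup>-\<alpha>\<^esup>; q)\<^sub>n / (q; q)\<^sub>n w\<^sup>n\<close> at \<open>w = q\<^bsup>1+s\<^esup>\<close>, which the \<open>q\<close>-binomial theorem sums to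
  \<open>(q\<^bsup>1+s-\<alpha>\<^esup>; q)\<^sub>\<infinity> / (q\<^bsup>1+s\<^esup>; q)\<^sub>\<infinity>\<close>, i.e. to a quotient of \<open>q\<close>-Gamma values. For the power series the
  double sum converges absolutely, because the \<open>q\<close>-binomial coefficients are bounded and the sum over
  \<open>n\<close> is dominated by a geometric series of ratio \<open>q\<^bsup>1+\<rho>\<^esup> < 1\<close>.
\<close>

section \<open>Infinite q-Pochhammer products\<close>

lemma convergent_prod_q_poch:
  fixes q s :: real
  assumes "0 < q" "q < 1"
  shows "convergent_prod (\<lambda>j. 1 - s * q ^ j)"
proof -
  have "summable (\<lambda>j. norm ((1 - s * q ^ j) - 1))"
    using assms by (auto simp: abs_mult power_abs intro!: summable_mult summable_geometric)
  then show ?thesis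
    by (intro abs_convergent_prod_imp_convergent_prod summable_imp_abs_convergent_prod)
qed

lemma q_poch_tendsto:
  assumes "0 < q" "q < 1"
  shows "q_poch q s \<longlonglongrightarrow> q_poch_inf q s"
proof (rule LIMSEQ_offset[where k = 1])
  \<comment> \<open>\<open>convergent_prod_LIMSEQ\<close> concerns products over
    \<open>{..n}\<close>, which have \<open>n + 1\<close> factors; hence the shift by one.\<close>
  show "(\<lambda>n. q_poch q s (n + 1)) \<longlonglongrightarrow> q_poch_inf q s"
    using convergent_prod_LIMSEQ[OF convergent_prod_q_poch[OF assms, of s]]
    by (simp add: q_poch_def[abs_def] q_poch_inf_def lessThan_Suc_atMost)
qed

lemma q_poch_factor_pos:
  fixes q w :: real
  assumes "0 < q" "q < 1" "\<bar>w\<bar> < 1"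
  shows "1 - w * q ^ j > 0"
proof -
  have "\<bar>w * q ^ j\<bar> \<le> \<bar>w\<bar> * 1"
    unfolding abs_mult using assms by (intro mult_left_mono) (auto simp: power_le_one)
  then show ?thesis using assms by linarith
qed

lemma q_poch_inf_nonzero:
  assumes "0 < q" "q < 1" "\<bar>w\<bar> < 1"
  shows "q_poch_inf q w \<noteq> 0"
  unfolding q_poch_inf_def
  using q_poch_factor_pos[OF assms]
  by (intro prodinf_nonzero convergent_prod_q_poch[OF assms(1,2)]) (auto simp: less_le)

section \<open>The q-binomial theorem\<close>

text \<open>With \<open>A = q powr (-\<alpha>)\<close> these are, up to the factor
  \<open>q ^ n\<close>, the weights in the series defining the fractional derivative of order
  \<alpha>.\<close>

definition q_binom_coeff :: "real \<Rightarrow> real \<Rightarrow> nat \<Rightarrow> real" where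
  "q_binom_coeff q A n = q_poch q A n / q_poch q q n"

lemma q_binom_coeff_0 [simp]: "q_binom_coeff q A 0 = 1"
  by (simp add: q_binom_coeff_def q_poch_def)

lemma q_binom_coeff_Suc:
  assumes "0 < q" "q < 1"
  shows "q_binom_coeff q A (Suc n) * (1 - q ^ Suc n) = q_binom_coeff q A n * (1 - A * q ^ n)"
  using q_poch_factor_pos[OF assms, of q n] assms
  by (simp add: q_binom_coeff_def q_poch_def)

text \<open>Numerator and denominator both converge to infinite products, and the limit of the
  denominator is nonzero.\<close>

lemma Bseq_q_binom_coeff:
  assumes "0 < q" "q < 1"
  shows "Bseq (q_binom_coeff q A)"
proof (rule convergent_imp_Bseq, rule convergentI)
  show "q_binom_coeff q A \<longlonglongrightarrow> q_poch_inf q A / q_poch_inf q q"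
    unfolding q_binom_coeff_def[abs_def]
    using q_poch_tendsto[OF assms] q_poch_inf_nonzero[OF assms, of q] assms
    by (intro tendsto_divide) auto
qed

lemma summable_q_binom:
  assumes "0 < q" "q < 1" "\<bar>w\<bar> < 1"
  shows "summable (\<lambda>n. q_binom_coeff q A n * w ^ n)"
proof -
  obtain C where C: "\<And>n. norm (q_binom_coeff q A n) \<le> C"
    using Bseq_q_binom_coeff[OF assms(1,2)] by (auto simp: Bseq_def)
  show ?thesis
  proof (rule summable_comparison_test')
    show "summable (\<lambda>n. C * \<bar>w\<bar> ^ n)"
      using assms by (intro summable_mult summable_geometric) auto
    show "norm (q_binom_coeff q A n * w ^ n) \<le> C * \<bar>w\<bar> ^ n" for n
      unfolding norm_mult using C[of n] by (auto simp: power_abs intro!: mult_right_mono)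
  qed
qed

text \<open>Compare coefficients of \<open>w ^ Suc n\<close> in
  \<open>F w - F (q * w) = w * (F w - A * F (q * w))\<close>: they agree by the ratio recurrence
  \<open>q_binom_coeff_Suc\<close>.\<close>

lemma q_binomial_step:
  fixes q w A :: real
  assumes q: "0 < q" "q < 1" and w: "\<bar>w\<bar> < 1"
  defines "F \<equiv> \<lambda>w. \<Sum>n. q_binom_coeff q A n * w ^ n"
  shows "(1 - w) * F w = (1 - A * w) * F (q * w)"
proof -
  let ?c = "q_binom_coeff q A"
  have "\<bar>q * w\<bar> \<le> 1 * \<bar>w\<bar>"
    unfolding abs_mult using q by (intro mult_right_mono) auto
  with w have qw: "\<bar>q * w\<bar> < 1" by linarith
  have F: "(\<lambda>n. ?c n * w ^ n) sums F w"
    unfolding F_def by (rule summable_sums[OF summable_q_binom[OF q w]])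
  have Fq: "(\<lambda>n. ?c n * (q * w) ^ n) sums F (q * w)"
    unfolding F_def by (rule summable_sums[OF summable_q_binom[OF q qw]])
  have "(\<lambda>n. w * (?c n * w ^ n - A * (?c n * (q * w) ^ n))) sums (w * (F w - A * F (q * w)))"
    by (intro sums_mult sums_diff F Fq)
  also have "(\<lambda>n. w * (?c n * w ^ n - A * (?c n * (q * w) ^ n)))
           = (\<lambda>n. ?c (Suc n) * w ^ Suc n - ?c (Suc n) * (q * w) ^ Suc n)"
  proof
    fix n
    have "w * (?c n * w ^ n - A * (?c n * (q * w) ^ n)) = w ^ Suc n * (?c n * (1 - A * q ^ n))"
      by (simp add: power_mult_distrib algebra_simps)
    also have "\<dots> = w ^ Suc n * (?c (Suc n) * (1 - q ^ Suc n))"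
      by (simp only: q_binom_coeff_Suc[OF q])
    also have "\<dots> = ?c (Suc n) * w ^ Suc n - ?c (Suc n) * (q * w) ^ Suc n"
      by (simp only: power_mult_distrib) (simp add: algebra_simps)
    finally show "w * (?c n * w ^ n - A * (?c n * (q * w) ^ n)) =
        ?c (Suc n) * w ^ Suc n - ?c (Suc n) * (q * w) ^ Suc n" .
  qed
  \<comment> \<open>The term at index 0 of \<open>F w - F (q * w)\<close> vanishes, so undoing the
    index shift leaves the sum unchanged.\<close>
  finally have "(\<lambda>n. ?c n * w ^ n - ?c n * (q * w) ^ n) sums (w * (F w - A * F (q * w)))"
    using sums_Suc_iff[of "\<lambda>n. ?c n * w ^ n - ?c n * (q * w) ^ n"] by simp
  from sums_unique2[OF this sums_diff[OF F Fq]]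
  show ?thesis by (simp add: algebra_simps)
qed

text \<open>Iterating the functional equation \<open>n\<close> times moves the argument to
  \<open>w * q ^ n\<close>; as \<open>n\<close> grows this tends to 0, where the series has value 1,
  and the accumulated finite products tend to the infinite ones.\<close>

theorem q_binomial_theorem:
  fixes q w A :: real
  assumes q: "0 < q" "q < 1" and w: "\<bar>w\<bar> < 1"
  shows "(\<lambda>n. q_binom_coeff q A n * w ^ n) sums (q_poch_inf q (A * w) / q_poch_inf q w)"
proof -
  define F where "F = (\<lambda>w. \<Sum>n. q_binom_coeff q A n * w ^ n)"
  have iter: "q_poch q w n * F w = q_poch q (A * w) n * F (w * q ^ n)" for n
  proof (induction n)
    case 0
    show ?case by (simp add: q_poch_def)
  next
    case (Suc n)
    have "\<bar>w * q ^ n\<bar> \<le> \<bar>w\<bar> * 1"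
      unfolding abs_mult using q by (intro mult_left_mono) (auto simp: power_le_one)
    with w have "\<bar>w * q ^ n\<bar> < 1" by linarith
    from q_binomial_step[OF q this, of A]
    have step: "(1 - w * q ^ n) * F (w * q ^ n) = (1 - A * w * q ^ n) * F (w * q ^ Suc n)"
      by (simp add: F_def mult_ac)
    have "q_poch q w (Suc n) * F w = (1 - w * q ^ n) * (q_poch q w n * F w)"
      by (simp add: q_poch_def mult_ac)
    also have "\<dots> = q_poch q (A * w) n * ((1 - w * q ^ n) * F (w * q ^ n))"
      unfolding Suc.IH by (simp only: mult_ac)
    also have "\<dots> = q_poch q (A * w) (Suc n) * F (w * q ^ Suc n)"
      by (simp only: step) (simp add: q_poch_def mult_ac)
    finally show ?case .
  qed
  \<comment> \<open>A power series is continuous inside its disc of convergence; 1/2 is merely some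
    point at which convergence is known.\<close>
  have "isCont F 0"
    unfolding F_def
    by (rule isCont_powser[where K = "1/2"]) (use summable_q_binom[OF q, of "1/2"] in auto)
  moreover have "(\<lambda>n. w * q ^ n) \<longlonglongrightarrow> 0"
    using q by (intro tendsto_mult_right_zero LIMSEQ_power_zero) auto
  ultimately have "(\<lambda>n. F (w * q ^ n)) \<longlonglongrightarrow> F 0"
    by (rule isCont_tendsto_compose)
  moreover have "F 0 = 1"
    using powser_zero[of "q_binom_coeff q A"] by (simp add: F_def)
  ultimately have "(\<lambda>n. q_poch q (A * w) n * F (w * q ^ n)) \<longlonglongrightarrow> q_poch_inf q (A * w) * 1"
    by (intro tendsto_mult q_poch_tendsto[OF q]) simp
  moreover have "(\<lambda>n. q_poch q w n * F w) \<longlonglongrightarrow> q_poch_inf q w * F w"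
    by (intro tendsto_mult q_poch_tendsto[OF q] tendsto_const)
  ultimately have "q_poch_inf q w * F w = q_poch_inf q (A * w)"
    unfolding iter using LIMSEQ_unique by fastforce
  then have "F w = q_poch_inf q (A * w) / q_poch_inf q w"
    using q_poch_inf_nonzero[OF q w] by (simp add: field_simps)
  then show ?thesis
    using summable_sums[OF summable_q_binom[OF q w, of A]] by (simp add: F_def)
qed

section \<open>Gamma quotients and the fractional derivative of a power\<close>

lemma q_Gamma_quotient:
  assumes "0 < q" "q < 1"
  shows "q_Gamma q (1 + s) / q_Gamma q (1 + s - \<alpha>) * (1 - q) powr \<alpha> =
    q_poch_inf q (q powr (1 + s - \<alpha>)) / q_poch_inf q (q powr (1 + s))"
proof -
  \<comment> \<open>Here \<open>x\<close> or \<open>y\<close> may be 0, in which case both sides are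
    0 because division by zero gives 0. This covers the poles of the q-Gamma function.\<close>
  have quotient: "(P / y * X) / (P / x * Y) * Z = x / y"
    if "P \<noteq> 0" "Y \<noteq> 0" "X * Z = Y" for P X Y Z x y :: real
  proof -
    have "(P / y * X) / (P / x * Y) * Z = (P / y) / (P / x) * ((X * Z) / Y)" by simp
    also have "\<dots> = x / y" using that by simp
    finally show ?thesis .
  qed
  show ?thesis
    unfolding q_Gamma_def
  proof (rule quotient)
    show "q_poch_inf q q \<noteq> 0"
      by (rule q_poch_inf_nonzero) (use assms in auto)
    show "(1 - q) powr (1 - (1 + s - \<alpha>)) \<noteq> 0"
      using assms by simp
    show "(1 - q) powr (1 - (1 + s)) * (1 - q) powr \<alpha> = (1 - q) powr (1 - (1 + s - \<alpha>))"
      by (simp flip: powr_add)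
  qed
qed

text \<open>This is the derivative series of a power with the power itself factored out: the
  q-binomial series at \<open>w = q powr (1 + s)\<close>, and \<open>s > -1\<close> is what puts
  \<open>w\<close> inside the unit disc.\<close>

lemma frac_q_deriv_power_sums:
  assumes q: "0 < q" "q < 1" and s: "s > -1"
  shows "(\<lambda>n. q_binom_coeff q (q powr (-\<alpha>)) n * q ^ n * (q ^ n) powr s) sums
    (q_Gamma q (1 + s) / q_Gamma q (1 + s - \<alpha>) * (1 - q) powr \<alpha>)"
proof -
  have "q powr (1 + s) < 1"
    using q s powr_less_mono'[of q 0 "1 + s"] by auto
  then have "\<bar>q powr (1 + s)\<bar> < 1" by simp
  from q_binomial_theorem[OF q this, of "q powr (-\<alpha>)"]
  have "(\<lambda>n. q_binom_coeff q (q powr (-\<alpha>)) n * (q powr (1 + s)) ^ n) sums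
     (q_poch_inf q (q powr (1 + s - \<alpha>)) / q_poch_inf q (q powr (1 + s)))"
    by (simp flip: powr_add)
  moreover have "(q powr (1 + s)) ^ n = q ^ n * (q ^ n) powr s" for n
    using q by (simp add: powr_add power_mult_distrib powr_power powr_realpow[symmetric] powr_powr mult_ac)
  ultimately show ?thesis
    unfolding q_Gamma_quotient[OF q] by (simp add: mult_ac)
qed

section \<open>Termwise fractional differentiation\<close>

text \<open>Fubini for series: the product majorant makes \<open>f\<close> absolutely summable over
  pairs, so its sum may be computed by rows or by columns.\<close>

lemma sums_swap_dominated:
  fixes f :: "nat \<Rightarrow> nat \<Rightarrow> 'a :: banach" and A B :: "nat \<Rightarrow> real"
  assumes bound: "\<And>n m. norm (f n m) \<le> A n * B m"
    and A: "summable A" "\<And>n. A n \<ge> 0" and B: "summable B" "\<And>m. B m \<ge> 0"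
    and R: "\<And>n. f n sums R n" and C: "\<And>m. (\<lambda>n. f n m) sums C m"
  shows "summable R" "C sums suminf R"
proof -
  have "(\<lambda>(n, m). A n * B m) summable_on UNIV \<times> UNIV"
  proof (rule summable_on_SigmaI)
    show "((\<lambda>m. case (n, m) of (n, m) \<Rightarrow> A n * B m) has_sum A n * suminf B) UNIV" for n
      using norm_summable_imp_has_sum[of B "suminf B"] B
      by (auto intro!: has_sum_cmult_right)
    show "(\<lambda>n. A n * suminf B) summable_on UNIV"
      using A B by (subst summable_on_UNIV_nonneg_real_iff)
        (auto intro!: summable_mult2 suminf_nonneg mult_nonneg_nonneg)
  qed (use A B in auto)
  then have "(\<lambda>x. norm (case x of (n, m) \<Rightarrow> f n m)) summable_on UNIV \<times> UNIV"
    by (rule Infinite_Sum.abs_summable_on_comparison_test') (use bound in auto)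
  then have "(\<lambda>(n, m). f n m) summable_on UNIV \<times> UNIV"
    by (rule abs_summable_summable)
  then obtain S where S: "((\<lambda>(n, m). f n m) has_sum S) (UNIV \<times> UNIV)"
    by (auto simp: summable_on_def)
  \<comment> \<open>Each row is dominated by a multiple of \<open>B\<close>, so its ordered sum is
    also its unordered sum, the notion used by \<open>has_sum_SigmaD\<close>.\<close>
  have "(f n has_sum R n) UNIV" for n
  proof (rule norm_summable_imp_has_sum[OF _ R], rule summable_comparison_test'[where N = 0])
    show "summable (\<lambda>m. A n * B m)" by (intro summable_mult B)
  qed (use bound in simp)
  then have "(R has_sum S) UNIV"
    using has_sum_SigmaD[OF S, of R] by auto
  then have RS: "R sums S" by (rule has_sum_imp_sums)
  have "((\<lambda>n. f n m) has_sum C m) UNIV" for m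
  proof (rule norm_summable_imp_has_sum[OF _ C], rule summable_comparison_test'[where N = 0])
    show "summable (\<lambda>n. A n * B m)" by (intro summable_mult2 A)
  qed (use bound in simp)
  moreover have swapped: "((\<lambda>(m, n). f n m) has_sum S) (UNIV \<times> UNIV)"
    using S by (subst has_sum_swap) simp
  ultimately have "(C has_sum S) UNIV"
    using has_sum_SigmaD[OF swapped, of C] by auto
  then have "C sums S" by (rule has_sum_imp_sums)
  with RS show "summable R" "C sums suminf R"
    by (auto simp: sums_iff)
qed

text \<open>No branch problem arises, since both sides are the exponential of the same multiple of
  \<open>Ln w\<close>. The series for \<open>u\<close> thereby becomes a power series in
  \<open>w powr of_real l\<close>.\<close>

lemma powr_of_nat_mult:
  fixes w :: complex
  assumes "w \<noteq> 0"
  shows "w powr of_real (real m * x) = (w powr of_real x) ^ m"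
  using assms by (simp add: powr_def exp_of_nat_mult[symmetric] mult_ac)

text \<open>Expanding \<open>u\<close> at each point \<open>q ^ n * z\<close> gives the double
  series \<open>T n m\<close>. Its row sums are the terms of the derivative series, its column sums
  are the derivatives of the single powers, and \<open>sums_swap_dominated\<close> equates the two
  orders of summation.\<close>

lemma frac_q_deriv_termwise:
  fixes z :: complex and d :: "nat \<Rightarrow> complex" and q l \<rho> \<alpha> :: real
  assumes q: "0 < q" "q < 1" and l: "l > 0" and \<rho>: "\<rho> > -1" and z: "z \<noteq> 0"
    and conv: "ereal (norm z powr l) < conv_radius d"
    and u: "\<And>w. u w = w powr of_real \<rho> * (\<Sum>m. d m * w powr of_real (real m * l))"
  shows "summable (frac_q_deriv_term q \<alpha> u z)"
    and "(\<lambda>m. d m * of_real (q_Gamma q (1 + \<rho> + real m * l) / q_Gamma q (1 + \<rho> + real m * l - \<alpha>))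
            * z powr of_real (\<rho> + real m * l - \<alpha>)) sums frac_q_deriv q \<alpha> u z"
proof -
  let ?s = "\<lambda>m. \<rho> + real m * l"
  define c where "c = q_binom_coeff q (q powr (-\<alpha>))"
  define Q where "Q = (\<lambda>m. q_Gamma q (1 + ?s m) / q_Gamma q (1 + ?s m - \<alpha>))"
  define T where "T = (\<lambda>n m. of_real (c n * q ^ n * (q ^ n) powr ?s m) * (d m * z powr of_real (?s m)))"
  obtain K where K: "K > 0" "\<And>n. norm (c n) \<le> K"
    using Bseq_q_binom_coeff[OF q] by (auto simp: Bseq_def c_def)
  define B where "B = (\<lambda>m. norm z powr \<rho> * norm (d m * (z powr of_real l) ^ m))"
  have norm_pow: "norm (w powr of_real x) = norm w powr x" for w :: complex and x
    by (simp add: norm_powr_real_powr')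
  have summable_norm: "summable (\<lambda>m. norm (d m * w ^ m))" if "norm w \<le> norm z powr l" for w
    by (rule abs_summable_in_conv_radius) (use that in \<open>simp add: le_less_trans[OF _ conv]\<close>)
  have geom: "q powr (1 + \<rho>) < 1"
    using q \<rho> powr_less_mono'[of q 0 "1 + \<rho>"] by auto
  have qpow: "q ^ n * (q ^ n) powr \<rho> = (q powr (1 + \<rho>)) ^ n" for n
    using q by (simp add: powr_add power_mult_distrib powr_power powr_realpow[symmetric] powr_powr mult_ac)
  \<comment> \<open>Since \<open>q ^ n\<close> is at most 1 and \<open>real m * l\<close> is
    nonnegative, replacing the exponent \<open>?s m\<close> by \<rho> only enlarges the real power;
    this separates \<open>n\<close> from \<open>m\<close>.\<close>
  have bound: "norm (T n m) \<le> (K * (q powr (1 + \<rho>)) ^ n) * B m" for n m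
  proof -
    have "(q ^ n) powr ?s m \<le> (q ^ n) powr \<rho>"
      using q l by (intro powr_mono') (auto simp: power_le_one)
    then have c: "norm (c n) * (q ^ n * (q ^ n) powr ?s m) \<le> K * (q ^ n * (q ^ n) powr \<rho>)"
      using K q by (intro mult_mono) auto
    have "norm (d m * z powr of_real (?s m)) = B m"
      by (simp add: B_def norm_mult norm_pow powr_add norm_power of_real_add flip: powr_of_nat_mult[OF z])
    moreover have "norm (complex_of_real (c n * q ^ n * (q ^ n) powr ?s m)) =
        norm (c n) * (q ^ n * (q ^ n) powr ?s m)"
      unfolding norm_of_real abs_mult using q by simp
    ultimately have "norm (T n m) = norm (c n) * (q ^ n * (q ^ n) powr ?s m) * B m"
      unfolding T_def norm_mult[of "of_real _"] by simp
    also have "\<dots> \<le> (K * (q powr (1 + \<rho>)) ^ n) * B m"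
      using c unfolding qpow by (intro mult_right_mono) (auto simp: B_def)
    finally show ?thesis .
  qed
  have B: "summable B" "\<And>m. B m \<ge> 0"
    unfolding B_def by (auto intro!: summable_mult summable_norm simp: norm_pow)
  have A: "summable (\<lambda>n. K * (q powr (1 + \<rho>)) ^ n)" "\<And>n. K * (q powr (1 + \<rho>)) ^ n \<ge> 0"
    using K geom by (auto intro!: summable_mult summable_geometric)
  have R: "T n sums frac_q_deriv_term q \<alpha> u z n" for n
  proof -
    let ?w = "of_real (q ^ n) * z"
    have w: "?w \<noteq> 0" using q z by simp
    \<comment> \<open>A positive real factor leaves the argument of \<open>z\<close> unchanged, so
      the principal power is multiplicative here.\<close>
    have pw: "?w powr of_real x = of_real ((q ^ n) powr x) * z powr of_real x" for x
      using q by (subst powr_times_real_left) (auto simp: powr_of_real simp flip: of_real_power)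
    have "norm ?w powr l \<le> norm z powr l"
      using q l by (intro powr_mono2)
        (auto simp: norm_mult norm_power power_le_one intro!: mult_left_le_one_le)
    then have "summable (\<lambda>m. norm (d m * (?w powr of_real l) ^ m))"
      by (intro summable_norm) (simp only: norm_pow)
    then have "(\<lambda>m. d m * ?w powr of_real (real m * l)) sums (\<Sum>m. d m * ?w powr of_real (real m * l))"
      unfolding powr_of_nat_mult[OF w] by (rule summable_sums[OF summable_norm_cancel])
    then have "(\<lambda>m. of_real (c n * q ^ n) * (?w powr of_real \<rho> * (d m * ?w powr of_real (real m * l)))) sums
        (of_real (c n * q ^ n) * u ?w)"
      unfolding u by (intro sums_mult)
    also have "(\<lambda>m. of_real (c n * q ^ n) * (?w powr of_real \<rho> * (d m * ?w powr of_real (real m * l)))) = T n"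
      unfolding T_def pw by (simp add: powr_add mult_ac)
    finally show ?thesis
      by (simp add: frac_q_deriv_term_def c_def q_binom_coeff_def)
  qed
  have C: "(\<lambda>n. T n m) sums (of_real (Q m * (1 - q) powr \<alpha>) * (d m * z powr of_real (?s m)))" for m
  proof -
    have "?s m > -1"
      using \<rho> l by (intro less_le_trans[OF \<rho>]) auto
    from frac_q_deriv_power_sums[OF q this, of \<alpha>] show ?thesis
      unfolding T_def Q_def c_def by (intro sums_mult2 sums_of_real)
  qed
  note swap = sums_swap_dominated[OF bound A B R C]
  show "summable (frac_q_deriv_term q \<alpha> u z)" by (rule swap(1))
  let ?x = "z powr of_real \<alpha> * of_real ((1 - q) powr \<alpha>)"
  have "(\<lambda>m. 1 / ?x * (of_real (Q m * (1 - q) powr \<alpha>) * (d m * z powr of_real (?s m))))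
      sums frac_q_deriv q \<alpha> u z"
    unfolding frac_q_deriv_def by (intro sums_mult swap(2))
  also have "(\<lambda>m. 1 / ?x * (of_real (Q m * (1 - q) powr \<alpha>) * (d m * z powr of_real (?s m)))) =
     (\<lambda>m. d m * of_real (Q m) * z powr of_real (?s m - \<alpha>))"
    using q z by (auto simp: powr_diff)
  finally show "(\<lambda>m. d m * of_real (q_Gamma q (1 + \<rho> + real m * l) / q_Gamma q (1 + \<rho> + real m * l - \<alpha>))
            * z powr of_real (\<rho> + real m * l - \<alpha>)) sums frac_q_deriv q \<alpha> u z"
    by (simp add: Q_def add.assoc)
qed

section \<open>The recurrence and the formal solution\<close>

lemma frac_q_gauss_coeff_Suc:
  assumes "frac_q_f q l c (Suc n) \<rho> \<noteq> 0"
  shows "frac_q_f q l c (Suc n) \<rho> * frac_q_gauss_coeff q l a b c \<rho> (Suc n) =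
    frac_q_g q l a b n \<rho> * frac_q_gauss_coeff q l a b c \<rho> n"
  using assms by (simp add: frac_q_gauss_coeff_def)

lemma formal_of_coeffs_at:
  assumes "l > 0"
  shows "formal_of_coeffs l \<rho> d (real n * l + \<rho>) = d n"
proof -
  have "{m. real n * l + \<rho> = real m * l + \<rho>} = {n}" using assms by auto
  then show ?thesis by (simp add: formal_of_coeffs_def)
qed

lemma formal_of_coeffs_outside:
  assumes "\<And>n. s \<noteq> real n * l + \<rho>"
  shows "formal_of_coeffs l \<rho> d s = 0"
  using assms by (simp add: formal_of_coeffs_def)

text \<open>Every operator in the equation shifts exponents by a multiple of \<open>l\<close>, and
  only the coefficients at \<open>s + l\<close> and \<open>s\<close> survive. Their factors are the
  expressions for f at index \<open>x + 1\<close> and g at index \<open>x\<close>; a real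
  \<open>x\<close> allows the index -1 and exponents off the grid.\<close>

lemma formal_q_gauss_lhs_at:
  assumes "s = \<rho> + x * l"
  shows "formal_q_gauss_lhs q l a b c U s =
      (of_real q powr c * of_real (q_Gamma q (1 + \<rho> + (x + 1) * l) / q_Gamma q (1 + \<rho> + (x - 1) * l))
       + q_bracket q c * of_real (q_Gamma q (1 + \<rho> + (x + 1) * l) / q_Gamma q (1 + \<rho> + x * l))) * U (s + l)
    - (of_real q powr (a + b + 1) * of_real (q_Gamma q (1 + \<rho> + x * l) / q_Gamma q (1 + \<rho> + (x - 2) * l))
       + (of_real q powr b * q_bracket q a + of_real q powr a * q_bracket q (b + 1))
         * of_real (q_Gamma q (1 + \<rho> + x * l) / q_Gamma q (1 + \<rho> + (x - 1) * l))
       + q_bracket q a * q_bracket q b) * U s"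
proof -
  have shift: "s - l + 2 * l = s + l" "s - l - l + 2 * l = s" "s - l + l = s"
    by simp_all
  have e: "s + l + 1 = 1 + \<rho> + (x + 1) * l" "s + l - 2 * l + 1 = 1 + \<rho> + (x - 1) * l"
    "s + 1 = 1 + \<rho> + x * l" "s - 2 * l + 1 = 1 + \<rho> + (x - 2) * l"
    "s + l - l + 1 = 1 + \<rho> + x * l" "s - l + 1 = 1 + \<rho> + (x - 1) * l"
    unfolding assms by (simp_all add: algebra_simps)
  show ?thesis
    unfolding formal_q_gauss_lhs_def Let_def formal_zpow_mult_def formal_q_deriv_def shift e
    by (simp add: algebra_simps)
qed

lemma formal_q_gauss_solution:
  assumes l: "l > 0" and f0: "frac_q_f q l c 0 \<rho> = 0"
    and rec: "\<And>n. frac_q_f q l c (Suc n) \<rho> * d (Suc n) = frac_q_g q l a b n \<rho> * d n"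
  shows "formal_q_gauss_lhs q l a b c (formal_of_coeffs l \<rho> d) s = 0"
proof -
  let ?U = "formal_of_coeffs l \<rho> d"
  \<comment> \<open>On the grid the recurrence cancels the two coefficients; one step below it only
    \<open>d 0\<close> enters, multiplied by f at index 0, which vanishes; elsewhere both
    coefficients are 0.\<close>
  consider (nat) n where "s = \<rho> + real n * l" | (lead) "s = \<rho> + (-1) * l"
    | (none) "\<And>n. s \<noteq> \<rho> + real n * l" "s \<noteq> \<rho> + (-1) * l" by blast
  then show ?thesis
  proof cases
    case nat
    have U: "?U s = d n" "?U (s + l) = d (Suc n)"
      using formal_of_coeffs_at[OF l, of \<rho> d n] formal_of_coeffs_at[OF l, of \<rho> d "Suc n"]
      by (simp_all add: nat algebra_simps)
    show ?thesis
      using rec[of n] unfolding formal_q_gauss_lhs_at[OF nat] U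
      by (simp add: frac_q_f_def frac_q_g_def add_ac)
  next
    case lead
    have "s \<noteq> real n * l + \<rho>" for n
    proof
      assume "s = real n * l + \<rho>"
      with lead have "(real n + 1) * l = 0" by (simp add: algebra_simps)
      with l show False by simp
    qed
    then have U: "?U s = 0" by (rule formal_of_coeffs_outside)
    show ?thesis
      using f0 unfolding formal_q_gauss_lhs_at[OF lead] U
      by (simp add: frac_q_f_def)
  next
    case none
    have U: "?U s = 0"
      by (rule formal_of_coeffs_outside) (use none in \<open>auto simp: add.commute\<close>)
    have "s + l \<noteq> real n * l + \<rho>" for n
      using none(1)[of "n - 1"] none(2) by (cases n) (auto simp: algebra_simps)
    then have U': "?U (s + l) = 0" by (rule formal_of_coeffs_outside)
    have s: "s = \<rho> + ((s - \<rho>) / l) * l" using l by simp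
    show ?thesis unfolding formal_q_gauss_lhs_at[OF s] U U' by simp
  qed
qed

section \<open>The solution as a function\<close>

text \<open>The terms of the equation are grouped into an f-series and a g-series. Dropping the
  vanishing first term of the f-series and shifting its index turns it, by the recurrence, into the
  g-series, so the two sums coincide.\<close>

lemma q_gauss_solution:
  fixes z :: complex and d :: "nat \<Rightarrow> complex"
  assumes q: "0 < q" "q < 1" and l: "l > 0" and \<rho>: "\<rho> > -1" and z: "z \<noteq> 0"
    and conv: "ereal (norm z powr l) < conv_radius d"
    and u: "\<And>w. u w = w powr of_real \<rho> * (\<Sum>m. d m * w powr of_real (real m * l))"
    and f0: "frac_q_f q l c 0 \<rho> = 0"
    and rec: "\<And>n. frac_q_f q l c (Suc n) \<rho> * d (Suc n) = frac_q_g q l a b n \<rho> * d n"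
  shows "q_gauss_lhs q l a b c u z = 0"
proof -
  let ?G = "\<lambda>x. q_Gamma q (1 + \<rho> + x * l)"
  let ?Z = "\<lambda>x. z powr of_real (\<rho> + x * l)"
  let ?zl = "z powr of_real l"
  let ?D2 = "frac_q_deriv q (2 * l) u z" and ?D1 = "frac_q_deriv q l u z"
  let ?e = "of_real q powr b * q_bracket q a + of_real q powr a * q_bracket q (b + 1)"
  have zl: "?zl * ?Z x = ?Z (x + 1)" for x
    using z by (simp add: powr_add[symmetric] of_real_add[symmetric] algebra_simps del: of_real_add)
  \<comment> \<open>\<open>Z1\<close> and \<open>Z2\<close> reduce powers of \<open>z\<close> to the
    lowest one, with index \<open>real m - 2\<close>, so that the termwise identities become pure
    ring identities.\<close>
  have Z1: "?Z (real m - 1) = ?zl * ?Z (real m - 2)" for m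
    using zl[of "real m - 2"] by (simp add: algebra_simps)
  have Z2: "?Z m = ?zl * ?Z (real m - 1)" for m
    using zl[of "real m - 1"] by (simp add: algebra_simps)
  have D2: "(\<lambda>m. d m * of_real (?G m / ?G (real m - 2)) * ?Z (real m - 2)) sums ?D2"
    using frac_q_deriv_termwise(2)[OF q l \<rho> z conv u, of "2 * l"]
    by (simp add: algebra_simps)
  have D1: "(\<lambda>m. d m * of_real (?G m / ?G (real m - 1)) * ?Z (real m - 1)) sums ?D1"
    using frac_q_deriv_termwise(2)[OF q l \<rho> z conv u, of l]
    by (simp add: algebra_simps)
  have "(\<lambda>m. frac_q_f q l c m \<rho> * d m * ?Z (real m - 1)) sums
      (?zl * of_real q powr c * ?D2 + q_bracket q c * ?D1)"
  proof -
    have "(\<lambda>m. ?zl * of_real q powr c * (d m * of_real (?G m / ?G (real m - 2)) * ?Z (real m - 2))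
          + q_bracket q c * (d m * of_real (?G m / ?G (real m - 1)) * ?Z (real m - 1))) sums
        (?zl * of_real q powr c * ?D2 + q_bracket q c * ?D1)"
      by (intro sums_add sums_mult D2 D1)
    moreover have "?zl * of_real q powr c * (d m * of_real (?G m / ?G (real m - 2)) * ?Z (real m - 2))
          + q_bracket q c * (d m * of_real (?G m / ?G (real m - 1)) * ?Z (real m - 1))
        = frac_q_f q l c m \<rho> * d m * ?Z (real m - 1)" for m
      unfolding frac_q_f_def Z1 by (simp only: ring_distribs mult_ac)
    ultimately show ?thesis by simp
  qed
  \<comment> \<open>The omitted term, of exponent \<open>\<rho> - l\<close>, is zero by
    \<open>f0\<close>.\<close>
  then have "(\<lambda>m. frac_q_f q l c (Suc m) \<rho> * d (Suc m) * ?Z (real (Suc m) - 1)) sums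
      (?zl * of_real q powr c * ?D2 + q_bracket q c * ?D1)"
    by (subst sums_Suc_iff) (simp add: f0)
  then have lhs: "(\<lambda>m. frac_q_g q l a b m \<rho> * d m * ?Z m) sums
      (?zl * of_real q powr c * ?D2 + q_bracket q c * ?D1)"
    by (simp add: rec)
  have "summable (\<lambda>m. norm (d m * ?zl ^ m))"
    by (rule abs_summable_in_conv_radius) (use conv in \<open>simp add: norm_powr_real_powr'\<close>)
  then have "(\<lambda>m. z powr of_real \<rho> * (d m * z powr of_real (real m * l))) sums u z"
    unfolding u powr_of_nat_mult[OF z] by (rule sums_mult[OF summable_sums[OF summable_norm_cancel]])
  then have uz: "(\<lambda>m. d m * ?Z m) sums u z"
    by (simp add: powr_add mult_ac)
  have "(\<lambda>m. ?zl * of_real q powr (a + b + 1) * ?zl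
            * (d m * of_real (?G m / ?G (real m - 2)) * ?Z (real m - 2))
          + ?e * ?zl * (d m * of_real (?G m / ?G (real m - 1)) * ?Z (real m - 1))
          + q_bracket q a * q_bracket q b * (d m * ?Z m)) sums
      (?zl * of_real q powr (a + b + 1) * ?zl * ?D2 + ?e * ?zl * ?D1
        + q_bracket q a * q_bracket q b * u z)"
    by (intro sums_add sums_mult D2 D1 uz)
  moreover have "?zl * of_real q powr (a + b + 1) * ?zl
            * (d m * of_real (?G m / ?G (real m - 2)) * ?Z (real m - 2))
          + ?e * ?zl * (d m * of_real (?G m / ?G (real m - 1)) * ?Z (real m - 1))
          + q_bracket q a * q_bracket q b * (d m * ?Z m)
        = frac_q_g q l a b m \<rho> * d m * ?Z m" for m
    unfolding frac_q_g_def Z2 Z1 by (simp only: ring_distribs mult_ac)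
  ultimately have "(\<lambda>m. frac_q_g q l a b m \<rho> * d m * ?Z m) sums
      (?zl * of_real q powr (a + b + 1) * ?zl * ?D2 + ?e * ?zl * ?D1
        + q_bracket q a * q_bracket q b * u z)"
    by simp
  from sums_unique2[OF lhs this] show ?thesis
    unfolding q_gauss_lhs_def by (simp add: algebra_simps)
qed

section \<open>Scaling by a constant and conclusion\<close>

lemma frac_q_deriv_term_cmult:
  "frac_q_deriv_term q \<alpha> (\<lambda>w. k * v w) z = (\<lambda>n. k * frac_q_deriv_term q \<alpha> v z n)"
  by (simp add: fun_eq_iff frac_q_deriv_term_def)

lemma frac_q_deriv_cmult:
  assumes "summable (frac_q_deriv_term q \<alpha> v z)"
  shows "frac_q_deriv q \<alpha> (\<lambda>w. k * v w) z = k * frac_q_deriv q \<alpha> v z"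
  unfolding frac_q_deriv_def frac_q_deriv_term_cmult suminf_mult[OF assms] by simp

lemma q_gauss_lhs_cmult:
  assumes "summable (frac_q_deriv_term q (2 * l) v z)" "summable (frac_q_deriv_term q l v z)"
  shows "q_gauss_lhs q l a b c (\<lambda>w. k * v w) z = k * q_gauss_lhs q l a b c v z"
  unfolding q_gauss_lhs_def frac_q_deriv_cmult[OF assms(1)] frac_q_deriv_cmult[OF assms(2)]
  by (simp add: algebra_simps)

text \<open>The nonvanishing of f at positive indices turns the product of quotients into the
  recurrence. Summability is asserted along with the equation for functions, so that both fractional
  derivatives are genuine sums of their defining series.\<close>

theorem theorem4:
  fixes q l \<rho> :: real and a b c u0 :: complex
  assumes "0 < q" "q < 1"
    and "0 < l" "l \<le> 1"
    and "\<rho> > -1"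
    and "frac_q_f q l c 0 \<rho> = 0"
    and "\<And>k. frac_q_f q l c (Suc k) \<rho> \<noteq> 0"
  shows "formal_q_gauss_lhs q l a b c
           (formal_of_coeffs l \<rho> (\<lambda>n. u0 * frac_q_gauss_coeff q l a b c \<rho> n)) = (\<lambda>s. 0)
       \<and> (\<forall>z. z \<noteq> 0 \<and> ereal (norm z powr l) < conv_radius (frac_q_gauss_coeff q l a b c \<rho>) \<longrightarrow>
            summable (frac_q_deriv_term q (2 * l) (frac_q_gauss q l a b c \<rho> u0) z)
          \<and> summable (frac_q_deriv_term q l (frac_q_gauss q l a b c \<rho> u0) z)
          \<and> q_gauss_lhs q l a b c (frac_q_gauss q l a b c \<rho> u0) z = 0)"
proof (intro conjI allI impI ext)
  let ?d = "\<lambda>n. u0 * frac_q_gauss_coeff q l a b c \<rho> n"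
  note rec = frac_q_gauss_coeff_Suc[OF assms(7)]
  have "frac_q_f q l c (Suc n) \<rho> * ?d (Suc n) = frac_q_g q l a b n \<rho> * ?d n" for n
    using rec[of n a b] by (simp add: mult.left_commute)
  then show "formal_q_gauss_lhs q l a b c (formal_of_coeffs l \<rho> ?d) s = 0" for s
    by (rule formal_q_gauss_solution[OF assms(3,6)])
next
  fix z :: complex
  assume z: "z \<noteq> 0 \<and> ereal (norm z powr l) < conv_radius (frac_q_gauss_coeff q l a b c \<rho>)"
  \<comment> \<open>The case \<open>u0 = 1\<close>: its coefficients are exactly those whose radius
    of convergence bounds \<open>z\<close>, and linearity restores the factor \<open>u0\<close>,
    including \<open>u0 = 0\<close>.\<close>
  define v where
    "v = (\<lambda>w. w powr of_real \<rho> * (\<Sum>m. frac_q_gauss_coeff q l a b c \<rho> m * w powr of_real (real m * l)))"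
  have u: "frac_q_gauss q l a b c \<rho> u0 = (\<lambda>w. u0 * v w)"
    by (simp add: fun_eq_iff frac_q_gauss_def v_def mult.assoc)
  note prems = assms(1,2,3,5) z[THEN conjunct1] z[THEN conjunct2] v_def[THEN fun_cong]
  note summable = frac_q_deriv_termwise(1)[OF prems]
  show "summable (frac_q_deriv_term q (2 * l) (frac_q_gauss q l a b c \<rho> u0) z)"
    "summable (frac_q_deriv_term q l (frac_q_gauss q l a b c \<rho> u0) z)"
    unfolding u frac_q_deriv_term_cmult by (intro summable_mult summable)+
  show "q_gauss_lhs q l a b c (frac_q_gauss q l a b c \<rho> u0) z = 0"
    unfolding u q_gauss_lhs_cmult[OF summable summable]
    using q_gauss_solution[OF prems assms(6) frac_q_gauss_coeff_Suc[OF assms(7)]] by simp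
qed

end
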